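(* Let $m\ge2$, $n\ge1$, and let $A\in\mathcal{M}_n(\mathbb{R})$ be a matrix which verifies $A^m=A$. For any constant vector $x_0\in\mathbb{R}^n$, the sequence $x\colon\mathbb{N}^m\to\mathbb{R}^n$, $x(t)=A^{t^1+\cdots+t^m}x_0$, verifies the diagonal recurrence $x(t+\mathbf{1})=Ax(t)$ for all $t\in\mathbb{N}^m$.
   Context: $\mathbb{N}=\{0,1,2,\dots\}$; $\mathcal{M}_n(\mathbb{R})$ is the set of real $n\times n$ matrices; $t=(t^1,\dots,t^m)\in\mathbb{N}^m$ (superscripts on $t$ are indices); $\mathbf{1}=(1,\dots,1)\in\mathbb{N}^m$; $A^0=I_n$. *)

theory Defs
  imports "Jordan_Normal_Form.Matrix"
begin

end

theory Submission
  imports Defs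
begin

text \<open>
  Adding the all-ones vector to \<open>t \<in> \<nat>\<^sup>m\<close> raises the exponent \<open>s = t\<^sup>1 + \<dots> + t\<^sup>m\<close> by exactly the
  number \<open>m\<close> of coordinates, so the matrix power picks up a factor \<open>A\<^sup>m\<close>, and the hypothesis
  collapses this factor to a single \<open>A\<close>: \<open>A\<^sup>s\<^sup>+\<^sup>m = A\<^sup>m A\<^sup>s = A A\<^sup>s\<close>. Applying both sides to
  the initial vector gives the recurrence. The only algebra involved is the exponent law
  \<open>pow_mat_add\<close>.
\<close>

lemma pow_mat_add:
  fixes A :: "'a :: semiring_1 mat"
  assumes A: "A \<in> carrier_mat n n"
  shows "A ^\<^sub>m (k + l) = A ^\<^sub>m k * A ^\<^sub>m l"
proof (induction l)
  case 0
  show ?case using A by simp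
next
  case (Suc l)
  have "A ^\<^sub>m (k + Suc l) = (A ^\<^sub>m k * A ^\<^sub>m l) * A"
    by (simp add: Suc)
  also have "\<dots> = A ^\<^sub>m k * (A ^\<^sub>m l * A)"
    using A by (intro assoc_mult_mat) (auto intro: pow_carrier_mat)
  finally show ?case by simp
qed

theorem theorem2:
  fixes m n :: nat
    and A :: "real mat"
    and x\<^sub>0 :: "real vec"
    and x :: "nat vec \<Rightarrow> real vec"
  assumes "2 \<le> m" and "1 \<le> n"
    and "A \<in> carrier_mat n n"
    and "A ^\<^sub>m m = A"
    and "x\<^sub>0 \<in> carrier_vec n"
    and "\<And>t. t \<in> carrier_vec m \<Longrightarrow> x t = (A ^\<^sub>m (\<Sum>i<m. t $ i)) *\<^sub>v x\<^sub>0"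
  shows "\<forall>t \<in> carrier_vec m. x (t + vec m (\<lambda>_. 1)) = A *\<^sub>v x t"
proof
  fix t :: "nat vec"
  assume t: "t \<in> carrier_vec m"
  let ?s = "\<Sum>i<m. t $ i"
  have "(\<Sum>i<m. (t + vec m (\<lambda>_. 1)) $ i) = (\<Sum>i<m. t $ i + 1)"
    using t by (intro sum.cong) auto
  also have "\<dots> = m + ?s"
    unfolding sum.distrib by simp
  finally have "x (t + vec m (\<lambda>_. 1)) = A ^\<^sub>m (m + ?s) *\<^sub>v x\<^sub>0"
    using assms(6)[of "t + vec m (\<lambda>_. 1)"] t by simp
  also have "A ^\<^sub>m (m + ?s) = A * A ^\<^sub>m ?s"
    using pow_mat_add[OF assms(3)] assms(4) by simp
  also have "(A * A ^\<^sub>m ?s) *\<^sub>v x\<^sub>0 = A *\<^sub>v (A ^\<^sub>m ?s *\<^sub>v x\<^sub>0)"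
    using assms(3,5) by (intro assoc_mult_mat_vec) (auto intro: pow_carrier_mat)
  also have "A ^\<^sub>m ?s *\<^sub>v x\<^sub>0 = x t"
    using assms(6)[OF t] by simp
  finally show "x (t + vec m (\<lambda>_. 1)) = A *\<^sub>v x t" .
qed

end
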